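(* Let $\mathcal{T}=(t_{ijkl})$ be a real 4th-order 3-dimensional symmetric tensor with $t_{iiii}>0$ for all $i\in\{1,2,3\}$. Assume one of the following three conditions holds: (a) $t_{1123}\geq-t_{1111}^{1/2}t_{2222}^{1/4}t_{3333}^{1/4}$, $t_{1223}\geq t_{1111}^{1/4}t_{2222}^{1/2}t_{3333}^{1/4}$, $t_{1233}\geq t_{1111}^{1/4}t_{2222}^{1/4}t_{3333}^{1/2}$; (b) $t_{1123}\geq t_{1111}^{1/2}t_{2222}^{1/4}t_{3333}^{1/4}$, $t_{1223}\geq-t_{1111}^{1/4}t_{2222}^{1/2}t_{3333}^{1/4}$, $t_{1233}\geq t_{1111}^{1/4}t_{2222}^{1/4}t_{3333}^{1/2}$; (c) $t_{1123}\geq t_{1111}^{1/2}t_{2222}^{1/4}t_{3333}^{1/4}$, $t_{1223}\geq t_{1111}^{1/4}t_{2222}^{1/2}t_{3333}^{1/4}$, $t_{1233}\geq-t_{1111}^{1/4}t_{2222}^{1/4}t_{3333}^{1/2}$. Then: (1) $\mathcal{T}$ is strictly copositive if for all $i,j\in\{1,2,3\}$ with $i\ne j$, $$t_{iijj}\geq -\sqrt{t_{iiii}t_{jjjj}},\qquad t_{iiij}\geq t_{iiii}^{3/4}t_{jjjj}^{1/4}.$$ (2) $\mathcal{T}$ is copositive if for all $i,j\in\{1,2,3\}$ with $i\ne j$, $$t_{iijj}\geq \sqrt{t_{iiii}t_{jjjj}},\qquad t_{iiij}\geq-t_{iiii}^{3/4}t_{jjjj}^{1/4},$$ and there is at least one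 $s\in\{1,2,3\}\setminus\{r\}$ such that $t_{rrrs}\geq t_{rrrr}^{3/4}t_{ssss}^{1/4}$, where $r=1$ if the assumed condition is (a), $r=2$ if it is (b), and $r=3$ if it is (c).
   Context: A 4th-order $n$-dimensional tensor $\mathcal{T}=(t_{ijkl})$ is symmetric if its entries are invariant under every permutation of the four indices. Put $\mathcal{T}x^4=\sum_{i,j,k,l=1}^n t_{ijkl}x_ix_jx_kx_l$ for $x\in\mathbb{R}^n$. $\mathcal{T}$ is copositive if $\mathcal{T}x^4\ge 0$ for all $x\in\mathbb{R}^n_+$ (the nonnegative orthant), and strictly copositive if $\mathcal{T}x^4>0$ for all $x\in\mathbb{R}^n_+\setminus\{0\}$. *)

theory Defs
  imports "HOL-Analysis.Analysis"
begin

type_synonym 'n tensor4 = "real ^ 'n ^ 'n ^ 'n ^ 'n"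

text \<open>The four index positions are numbered \<open>1, \<dots>, 4\<close>; \<open>\<sigma>\<close> permutes positions,
  not the values of the indices.\<close>

definition symmetric_tensor4 :: "('n::finite) tensor4 \<Rightarrow> bool" where
  "symmetric_tensor4 T \<longleftrightarrow>
     (\<forall>\<sigma> (\<iota> :: nat \<Rightarrow> 'n). \<sigma> permutes {1..4} \<longrightarrow>
        T $ \<iota> (\<sigma> 1) $ \<iota> (\<sigma> 2) $ \<iota> (\<sigma> 3) $ \<iota> (\<sigma> 4) = T $ \<iota> 1 $ \<iota> 2 $ \<iota> 3 $ \<iota> 4)"

definition tensor4_form :: "('n::finite) tensor4 \<Rightarrow> real ^ 'n \<Rightarrow> real" where
  "tensor4_form T x =
     (\<Sum>i\<in>UNIV. \<Sum>j\<in>UNIV. \<Sum>k\<in>UNIV. \<Sum>l\<in>UNIV.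
        T $ i $ j $ k $ l * x $ i * x $ j * x $ k * x $ l)"

definition nonneg_orthant :: "(real ^ ('n::finite)) set" where
  "nonneg_orthant = {x. \<forall>i. 0 \<le> x $ i}"

definition copositive4 :: "('n::finite) tensor4 \<Rightarrow> bool" where
  "copositive4 T \<longleftrightarrow> (\<forall>x\<in>nonneg_orthant. 0 \<le> tensor4_form T x)"

definition strictly_copositive4 :: "('n::finite) tensor4 \<Rightarrow> bool" where
  "strictly_copositive4 T \<longleftrightarrow> (\<forall>x\<in>nonneg_orthant - {0}. 0 < tensor4_form T x)"

end

theory Submission
  imports Defs
begin

text \<open>
  Write \<open>a\<^sub>i\<close> for the fourth root of \<open>t\<^sub>i\<^sub>i\<^sub>i\<^sub>i\<close>. Substituting \<open>u\<^sub>i = a\<^sub>i x\<^sub>i\<close> preserves the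
  orthant and divides each entry \<open>t\<^sub>i\<^sub>j\<^sub>k\<^sub>l\<close> by \<open>a\<^sub>i a\<^sub>j a\<^sub>k a\<^sub>l\<close>, so the diagonal becomes \<open>1\<close> and every
  hypothesis becomes a comparison of an entry with \<open>1\<close> or \<open>-1\<close>. On the orthant all monomials are
  nonnegative, so the form is smallest when these comparisons are equalities. It remains to bound
  two explicit ternary quartics in \<open>x, y, z \<ge> 0\<close>, where \<open>x\<close> carries the exceptional index \<open>r\<close>.

  For strict copositivity the quartic is
  \<open>(x\<^sup>2+y\<^sup>2+z\<^sup>2)\<^sup>2 + 4xy(x-y)\<^sup>2 + 4xz(x-z)\<^sup>2 + 4yz(y-z)\<^sup>2 - 12xyz(x-y-z)\<close>.
  The last term is harmful only if \<open>d = x - y - z\<close> is positive; then \<open>(x-y)\<^sup>2 = (z+d)\<^sup>2 \<ge> 4zd\<close> and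
  \<open>(x-z)\<^sup>2 \<ge> 4yd\<close>, so the second and third terms give \<open>32xyzd\<close>, which absorbs \<open>12xyzd\<close>
  (\<open>strict_extremal_quartic_pos\<close>).

  For copositivity, with \<open>y\<close> carrying the index \<open>s\<close> of the extra hypothesis, the quartic is
  \<open>(x+y-z)\<^sup>4 - 8xy\<^sup>2(y-3z)\<close>. Only the case \<open>y > 3z\<close> is in question: put \<open>w = y - z\<close>; then \<open>y\<^sup>2(y-3z) \<le> w\<^sup>3\<close>, and
  \<open>(x+w)\<^sup>4 \<ge> 8xw\<^sup>3\<close> (\<open>extremal_quartic_nonneg\<close>).
\<close>

section \<open>The two extremal ternary quartics\<close>

text \<open>Since \<open>4x\<^sup>3y - 8x\<^sup>2y\<^sup>2 + 4xy\<^sup>3 = 4xy(x-y)\<^sup>2\<close>, the pairs leave \<open>2x\<^sup>2y\<^sup>2\<close> each, and these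
  complete the pure powers to \<open>(x\<^sup>2+y\<^sup>2+z\<^sup>2)\<^sup>2\<close>, which makes the bound strict.\<close>

lemma strict_extremal_quartic_pos:
  fixes x y z :: real
  assumes "0 \<le> x" "0 \<le> y" "0 \<le> z" and nz: "x \<noteq> 0 \<or> y \<noteq> 0 \<or> z \<noteq> 0"
  shows "0 < x^4 + y^4 + z^4
      + 4 * (x^3 * y + x^3 * z + y^3 * x + y^3 * z + z^3 * x + z^3 * y)
      - 6 * (x^2 * y^2 + x^2 * z^2 + y^2 * z^2)
      + 12 * (- (x^2 * y * z) + x * y^2 * z + x * y * z^2)" (is "0 < ?F")
proof -
  define d where "d = x - y - z"
  define Q where "Q = (x^2 + y^2 + z^2)^2"
  define P where "P = x * y * z * d"
  define A where "A = x * y * (x - y)^2"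
  define B where "B = x * z * (x - z)^2"
  define C where "C = y * z * (y - z)^2"
  have F: "?F = Q + 4 * A + 4 * B + 4 * C - 12 * P"
    unfolding Q_def P_def A_def B_def C_def d_def by algebra
  have pos: "0 < Q"
    unfolding Q_def using nz by (metis add_nonneg_eq_0_iff add_nonneg_nonneg power_zero_numeral
        zero_le_power2 zero_less_power2 zero_eq_power2)
  have xyz: "0 \<le> x * y * z"
    using assms by simp
  have squares: "0 \<le> A" "0 \<le> B" "0 \<le> C"
    unfolding A_def B_def C_def using assms by simp_all
  show ?thesis
  proof (cases "d \<le> 0")
    case True
    then have "P \<le> 0"
      unfolding P_def using xyz by (simp add: mult_nonneg_nonpos)
    then show ?thesis
      unfolding F using pos squares by linarith
  next
    case False
    have "x * y * (4 * z * d) \<le> A"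
      unfolding A_def
    proof (rule mult_left_mono)
      have "(x - y)^2 - 4 * z * d = (z - d)^2"
        unfolding d_def by algebra
      then show "4 * z * d \<le> (x - y)^2"
        by (metis diff_ge_0_iff_ge zero_le_power2)
    qed (use assms in simp)
    moreover have "x * z * (4 * y * d) \<le> B"
      unfolding B_def
    proof (rule mult_left_mono)
      have "(x - z)^2 - 4 * y * d = (y - d)^2"
        unfolding d_def by algebra
      then show "4 * y * d \<le> (x - z)^2"
        by (metis diff_ge_0_iff_ge zero_le_power2)
    qed (use assms in simp)
    moreover have "x * y * (4 * z * d) = 4 * P" "x * z * (4 * y * d) = 4 * P"
      by (simp_all add: P_def)
    moreover have "0 \<le> P"
      unfolding P_def using xyz False by simp
    ultimately show ?thesis
      unfolding F using pos squares by linarith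
  qed
qed

lemma eight_mult_cube_le_fourth_power:
  fixes x w :: real
  assumes "0 \<le> x" "0 \<le> w"
  shows "8 * x * w^3 \<le> (x + w)^4"
proof -
  have "(x + w)^4 - 8 * x * w^3 = x^4 + 4 * (x^3 * w) + 2 * (x^2 * w^2) + (w^2 - 2 * x * w)^2"
    by algebra
  moreover have "0 \<le> x^4 + 4 * (x^3 * w) + 2 * (x^2 * w^2) + (w^2 - 2 * x * w)^2"
    using assms by simp
  ultimately show ?thesis
    by linarith
qed

text \<open>The only coefficient of type (3,1) that is not negative is that of \<open>x\<^sup>3y\<close>. This makes the
  signs agree with those of \<open>(x+y-z)\<^sup>4\<close> except at \<open>xy\<^sup>3\<close> and \<open>xy\<^sup>2z\<close>.\<close>

lemma extremal_quartic_nonneg: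
  fixes x y z :: real
  assumes "0 \<le> x" "0 \<le> y" "0 \<le> z"
  shows "0 \<le> x^4 + y^4 + z^4
      + 4 * (x^3 * y - x^3 * z - y^3 * x - y^3 * z - z^3 * x - z^3 * y)
      + 6 * (x^2 * y^2 + x^2 * z^2 + y^2 * z^2)
      + 12 * (- (x^2 * y * z) + x * y^2 * z + x * y * z^2)" (is "0 \<le> ?G")
proof -
  have G: "?G = (x + y - z)^4 + 8 * x * (y^2 * (3 * z - y))"
    by algebra
  show ?thesis
  proof (cases "y \<le> 3 * z")
    case True
    then show ?thesis
      unfolding G using assms by simp
  next
    case False
    define w where "w = y - z"
    have w: "0 \<le> w"
      using False assms by (simp add: w_def)
    have "w^3 + y^2 * (3 * z - y) = z^2 * (3 * y - z)"
      unfolding w_def by algebra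
    also have "0 \<le> \<dots>"
      using False assms by simp
    finally have "0 \<le> 8 * x * (w^3 + y^2 * (3 * z - y))"
      using assms by simp
    then have "0 \<le> 8 * x * w^3 + 8 * x * (y^2 * (3 * z - y))"
      by (simp add: distrib_left)
    moreover have "8 * x * w^3 \<le> (x + y - z)^4"
      using eight_mult_cube_le_fourth_power[OF \<open>0 \<le> x\<close> w] by (simp add: w_def algebra_simps)
    ultimately show ?thesis
      unfolding G by linarith
  qed
qed

section \<open>Symmetric ternary quartic forms\<close>

lemma symmetric_tensor4_swaps:
  assumes "symmetric_tensor4 T"
  shows "T $ i $ j $ k $ l = T $ j $ i $ k $ l"
    and "T $ i $ j $ k $ l = T $ i $ k $ j $ l"
    and "T $ i $ j $ k $ l = T $ i $ j $ l $ k"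
proof -
  define \<iota> :: "nat \<Rightarrow> 'a" where "\<iota> n = (if n = 1 then i else if n = 2 then j else if n = 3 then k else l)" for n
  have swap: "T $ \<iota> (\<sigma> 1) $ \<iota> (\<sigma> 2) $ \<iota> (\<sigma> 3) $ \<iota> (\<sigma> 4) = T $ \<iota> 1 $ \<iota> 2 $ \<iota> 3 $ \<iota> 4"
    if "\<sigma> = Transposition.transpose a b" "a \<in> {1..4}" "b \<in> {1..4}" for \<sigma> a b
    using assms permutes_swap_id[of a "{1..4}" b] that unfolding symmetric_tensor4_def by blast
  show "T $ i $ j $ k $ l = T $ j $ i $ k $ l"
    using swap[OF refl, of 1 2] by (simp add: \<iota>_def Transposition.transpose_def)
  show "T $ i $ j $ k $ l = T $ i $ k $ j $ l"
    using swap[OF refl, of 2 3] by (simp add: \<iota>_def Transposition.transpose_def)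
  show "T $ i $ j $ k $ l = T $ i $ j $ l $ k"
    using swap[OF refl, of 3 4] by (simp add: \<iota>_def Transposition.transpose_def)
qed

lemma UNIV_3_distinct:
  fixes p q s :: 3
  assumes "distinct [p, q, s]"
  shows "UNIV = {p, q, s}"
  using assms by (intro card_seteq[symmetric]) auto

text \<open>The indices are kept arbitrary, so that one expansion serves each choice of the exceptional
  index.\<close>

lemma tensor4_form_3_expand:
  fixes T :: "3 tensor4"
  assumes sym: "symmetric_tensor4 T" and dist: "distinct [p, q, s]"
  shows "tensor4_form T v =
      T $ p $ p $ p $ p * (v $ p)^4 + T $ q $ q $ q $ q * (v $ q)^4 + T $ s $ s $ s $ s * (v $ s)^4
      + 4 * (T $ p $ p $ p $ q * ((v $ p)^3 * v $ q) + T $ p $ p $ p $ s * ((v $ p)^3 * v $ s)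
           + T $ q $ q $ q $ p * ((v $ q)^3 * v $ p) + T $ q $ q $ q $ s * ((v $ q)^3 * v $ s)
           + T $ s $ s $ s $ p * ((v $ s)^3 * v $ p) + T $ s $ s $ s $ q * ((v $ s)^3 * v $ q))
      + 6 * (T $ p $ p $ q $ q * ((v $ p)^2 * (v $ q)^2) + T $ p $ p $ s $ s * ((v $ p)^2 * (v $ s)^2)
           + T $ q $ q $ s $ s * ((v $ q)^2 * (v $ s)^2))
      + 12 * (T $ p $ p $ q $ s * ((v $ p)^2 * v $ q * v $ s) + T $ p $ q $ q $ s * (v $ p * (v $ q)^2 * v $ s)
           + T $ p $ q $ s $ s * (v $ p * v $ q * (v $ s)^2))"
proof -
  have sum3: "sum f UNIV = f p + f q + f s" for f :: "3 \<Rightarrow> real"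
    unfolding UNIV_3_distinct[OF dist] using dist by (simp add: add.assoc)
  note swaps = symmetric_tensor4_swaps[OF sym]
  \<comment> \<open>As ordered rewrite rules the adjacent swaps sort the indices of every entry, which
    collects the 81 terms into 15 monomials.\<close>
  show ?thesis
    unfolding tensor4_form_def sum3
    by (simp add: swaps power4_eq_xxxx power3_eq_cube power2_eq_square algebra_simps)
qed

section \<open>Symmetric tensors with unit diagonal\<close>

text \<open>Here \<open>p\<close> is the exceptional index, so \<open>v\<^sub>p\<close> plays the part of \<open>x\<close> in the extremal quartics;
  \<open>v\<^sub>q\<close> and \<open>v\<^sub>s\<close> play those of \<open>y\<close> and \<open>z\<close>. Both bounds compare the form with its extremal
  quartic monomial by monomial.\<close>

context
  fixes S :: "3 tensor4" and p q s :: 3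
  assumes sym: "symmetric_tensor4 S" and dist: "distinct [p, q, s]"
    and unit: "\<And>i. S $ i $ i $ i $ i = 1"
    and mixed: "- 1 \<le> S $ p $ p $ q $ s" "1 \<le> S $ p $ q $ q $ s" "1 \<le> S $ p $ q $ s $ s"
begin

lemma unit_diagonal_form_pos:
  assumes sq: "\<And>i j. i \<noteq> j \<Longrightarrow> - 1 \<le> S $ i $ i $ j $ j"
    and cub: "\<And>i j. i \<noteq> j \<Longrightarrow> 1 \<le> S $ i $ i $ i $ j"
    and v: "v \<in> nonneg_orthant - {0}"
  shows "0 < tensor4_form S v"
proof -
  have nn: "0 \<le> v $ i" for i
    using v by (simp add: nonneg_orthant_def)
  have "v $ p \<noteq> 0 \<or> v $ q \<noteq> 0 \<or> v $ s \<noteq> 0"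
    using v UNIV_3_distinct[OF dist] by (auto simp: vec_eq_iff)
  note low = strict_extremal_quartic_pos[OF nn nn nn this]
  have scale: "c * m \<le> t * m" if "c \<le> t" "0 \<le> m" for c t m :: real
    using that by (rule mult_right_mono)
  have c: "(v $ i)^3 * v $ j \<le> S $ i $ i $ i $ j * ((v $ i)^3 * v $ j)" if "i \<noteq> j" for i j
    using scale[OF cub[OF that], of "(v $ i)^3 * v $ j"] nn by simp
  have b: "- ((v $ i)^2 * (v $ j)^2) \<le> S $ i $ i $ j $ j * ((v $ i)^2 * (v $ j)^2)" if "i \<noteq> j" for i j
    using scale[OF sq[OF that], of "(v $ i)^2 * (v $ j)^2"] by simp
  have ne: "p \<noteq> q" "p \<noteq> s" "q \<noteq> p" "q \<noteq> s" "s \<noteq> p" "s \<noteq> q"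
    using dist by auto
  have m: "- ((v $ p)^2 * v $ q * v $ s) \<le> S $ p $ p $ q $ s * ((v $ p)^2 * v $ q * v $ s)"
      "v $ p * (v $ q)^2 * v $ s \<le> S $ p $ q $ q $ s * (v $ p * (v $ q)^2 * v $ s)"
      "v $ p * v $ q * (v $ s)^2 \<le> S $ p $ q $ s $ s * (v $ p * v $ q * (v $ s)^2)"
    using scale[OF mixed(1), of "(v $ p)^2 * v $ q * v $ s"] scale[OF mixed(2), of "v $ p * (v $ q)^2 * v $ s"]
      scale[OF mixed(3), of "v $ p * v $ q * (v $ s)^2"] nn
    by simp_all
  show ?thesis
    unfolding tensor4_form_3_expand[OF sym dist] unit
    using low c[OF ne(1)] c[OF ne(2)] c[OF ne(3)] c[OF ne(4)] c[OF ne(5)] c[OF ne(6)]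
      b[OF ne(1)] b[OF ne(2)] b[OF ne(4)] m
    by (simp only: mult_1_left mult_minus_left distrib_left right_diff_distrib)
qed

lemma unit_diagonal_form_nonneg:
  assumes sq: "\<And>i j. i \<noteq> j \<Longrightarrow> 1 \<le> S $ i $ i $ j $ j"
    and cub: "\<And>i j. i \<noteq> j \<Longrightarrow> - 1 \<le> S $ i $ i $ i $ j"
    and pq: "1 \<le> S $ p $ p $ p $ q"
    and v: "v \<in> nonneg_orthant"
  shows "0 \<le> tensor4_form S v"
proof -
  have nn: "0 \<le> v $ i" for i
    using v by (simp add: nonneg_orthant_def)
  note low = extremal_quartic_nonneg[OF nn[of p] nn[of q] nn[of s]]
  have scale: "c * m \<le> t * m" if "c \<le> t" "0 \<le> m" for c t m :: real
    using that by (rule mult_right_mono)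
  have c: "- ((v $ i)^3 * v $ j) \<le> S $ i $ i $ i $ j * ((v $ i)^3 * v $ j)" if "i \<noteq> j" for i j
    using scale[OF cub[OF that], of "(v $ i)^3 * v $ j"] nn by simp
  have b: "(v $ i)^2 * (v $ j)^2 \<le> S $ i $ i $ j $ j * ((v $ i)^2 * (v $ j)^2)" if "i \<noteq> j" for i j
    using scale[OF sq[OF that], of "(v $ i)^2 * (v $ j)^2"] by simp
  have ne: "p \<noteq> q" "p \<noteq> s" "q \<noteq> p" "q \<noteq> s" "s \<noteq> p" "s \<noteq> q"
    using dist by auto
  have m: "- ((v $ p)^2 * v $ q * v $ s) \<le> S $ p $ p $ q $ s * ((v $ p)^2 * v $ q * v $ s)"
      "v $ p * (v $ q)^2 * v $ s \<le> S $ p $ q $ q $ s * (v $ p * (v $ q)^2 * v $ s)"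
      "v $ p * v $ q * (v $ s)^2 \<le> S $ p $ q $ s $ s * (v $ p * v $ q * (v $ s)^2)"
    using scale[OF mixed(1), of "(v $ p)^2 * v $ q * v $ s"] scale[OF mixed(2), of "v $ p * (v $ q)^2 * v $ s"]
      scale[OF mixed(3), of "v $ p * v $ q * (v $ s)^2"] nn
    by simp_all
  have pq_mon: "0 \<le> (v $ p)^3 * v $ q"
    using nn by simp
  show ?thesis
    unfolding tensor4_form_3_expand[OF sym dist] unit
    using low scale[OF pq pq_mon] c[OF ne(2)] c[OF ne(3)] c[OF ne(4)] c[OF ne(5)] c[OF ne(6)]
      b[OF ne(1)] b[OF ne(2)] b[OF ne(4)] m
    by (simp only: mult_1_left mult_minus_left distrib_left right_diff_distrib)
qed

end

section \<open>Rescaling to unit diagonal\<close>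

definition rescale_tensor4 :: "('n::finite \<Rightarrow> real) \<Rightarrow> 'n tensor4 \<Rightarrow> 'n tensor4" where
  "rescale_tensor4 a T = (\<chi> i j k l. T $ i $ j $ k $ l / (a i * a j * a k * a l))"

lemma rescale_tensor4_nth [simp]:
  "rescale_tensor4 a T $ i $ j $ k $ l = T $ i $ j $ k $ l / (a i * a j * a k * a l)"
  by (simp add: rescale_tensor4_def)

lemma symmetric_rescale_tensor4:
  assumes "symmetric_tensor4 T"
  shows "symmetric_tensor4 (rescale_tensor4 a T)"
  unfolding symmetric_tensor4_def
proof (intro allI impI)
  fix \<sigma> :: "nat \<Rightarrow> nat" and \<iota> :: "nat \<Rightarrow> 'a"
  assume \<sigma>: "\<sigma> permutes {1..4}"
  have four: "{1..4} = {1, 2, 3, 4::nat}"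
    by auto
  have "(\<Prod>n\<in>{1..4}. a (\<iota> (\<sigma> n))) = (\<Prod>n\<in>{1..4}. a (\<iota> n))"
    using prod.permute[OF \<sigma>, of "\<lambda>n. a (\<iota> n)"] by (simp add: o_def)
  then have "a (\<iota> (\<sigma> 1)) * a (\<iota> (\<sigma> 2)) * a (\<iota> (\<sigma> 3)) * a (\<iota> (\<sigma> 4)) = a (\<iota> 1) * a (\<iota> 2) * a (\<iota> 3) * a (\<iota> 4)"
    unfolding four by (simp add: mult.assoc)
  moreover have "T $ \<iota> (\<sigma> 1) $ \<iota> (\<sigma> 2) $ \<iota> (\<sigma> 3) $ \<iota> (\<sigma> 4) = T $ \<iota> 1 $ \<iota> 2 $ \<iota> 3 $ \<iota> 4"
    using assms \<sigma> unfolding symmetric_tensor4_def by blast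
  ultimately show "rescale_tensor4 a T $ \<iota> (\<sigma> 1) $ \<iota> (\<sigma> 2) $ \<iota> (\<sigma> 3) $ \<iota> (\<sigma> 4) =
      rescale_tensor4 a T $ \<iota> 1 $ \<iota> 2 $ \<iota> 3 $ \<iota> 4"
    by simp
qed

lemma tensor4_form_rescale:
  assumes "\<And>i. a i \<noteq> 0"
  shows "tensor4_form T x = tensor4_form (rescale_tensor4 a T) (\<chi> i. a i * x $ i)"
  unfolding tensor4_form_def by (intro sum.cong refl) (use assms in \<open>simp add: field_simps\<close>)

lemma nonneg_orthant_rescale:
  assumes "\<And>i. 0 < a i" "x \<in> nonneg_orthant"
  shows "(\<chi> i. a i * x $ i) \<in> nonneg_orthant"
  using assms by (simp add: nonneg_orthant_def less_imp_le)

lemma rescale_eq_0_iff: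
  fixes a :: "'n::finite \<Rightarrow> real"
  assumes "\<And>i. a i \<noteq> 0"
  shows "(\<chi> i. a i * x $ i) = 0 \<longleftrightarrow> x = 0"
  using assms by (simp add: vec_eq_iff)

text \<open>In terms of fourth roots all the bounds on \<open>t\<^sub>i\<^sub>j\<^sub>k\<^sub>l\<close> become \<open>\<plusminus> a\<^sub>i a\<^sub>j a\<^sub>k a\<^sub>l\<close>, the denominators
  of the rescaled entries.\<close>

lemma fourth_root_powers:
  fixes t :: real
  assumes "0 < t"
  shows "t powr (1/2) = (t powr (1/4))^2" "t powr (3/4) = (t powr (1/4))^3"
    and "(t powr (1/4))^4 = t" "sqrt t = (t powr (1/4))^2"
proof -
  have *: "(t powr (1/4))^n = t powr (of_nat n / 4)" for n
    using assms by (simp add: powr_realpow[symmetric] powr_powr)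
  show "t powr (1/2) = (t powr (1/4))^2" "t powr (3/4) = (t powr (1/4))^3" "(t powr (1/4))^4 = t"
    using assms by (simp_all add: *)
  then show "sqrt t = (t powr (1/4))^2"
    using assms by (simp add: powr_half_sqrt)
qed

section \<open>The copositivity criteria\<close>

theorem theorem3p9:
  fixes T :: "3 tensor4" and r :: 3
  assumes sym: "symmetric_tensor4 T"
    and diag: "\<And>i. 0 < T $ i $ i $ i $ i"
    and cases_abc:
      "(r = 1 \<and>
          T $ 1 $ 1 $ 2 $ 3 \<ge> - ((T $ 1 $ 1 $ 1 $ 1) powr (1/2) * (T $ 2 $ 2 $ 2 $ 2) powr (1/4) * (T $ 3 $ 3 $ 3 $ 3) powr (1/4)) \<and>
          T $ 1 $ 2 $ 2 $ 3 \<ge> (T $ 1 $ 1 $ 1 $ 1) powr (1/4) * (T $ 2 $ 2 $ 2 $ 2) powr (1/2) * (T $ 3 $ 3 $ 3 $ 3) powr (1/4) \<and>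
          T $ 1 $ 2 $ 3 $ 3 \<ge> (T $ 1 $ 1 $ 1 $ 1) powr (1/4) * (T $ 2 $ 2 $ 2 $ 2) powr (1/4) * (T $ 3 $ 3 $ 3 $ 3) powr (1/2))
       \<or>
       (r = 2 \<and>
          T $ 1 $ 1 $ 2 $ 3 \<ge> (T $ 1 $ 1 $ 1 $ 1) powr (1/2) * (T $ 2 $ 2 $ 2 $ 2) powr (1/4) * (T $ 3 $ 3 $ 3 $ 3) powr (1/4) \<and>
          T $ 1 $ 2 $ 2 $ 3 \<ge> - ((T $ 1 $ 1 $ 1 $ 1) powr (1/4) * (T $ 2 $ 2 $ 2 $ 2) powr (1/2) * (T $ 3 $ 3 $ 3 $ 3) powr (1/4)) \<and>
          T $ 1 $ 2 $ 3 $ 3 \<ge> (T $ 1 $ 1 $ 1 $ 1) powr (1/4) * (T $ 2 $ 2 $ 2 $ 2) powr (1/4) * (T $ 3 $ 3 $ 3 $ 3) powr (1/2))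
       \<or>
       (r = 3 \<and>
          T $ 1 $ 1 $ 2 $ 3 \<ge> (T $ 1 $ 1 $ 1 $ 1) powr (1/2) * (T $ 2 $ 2 $ 2 $ 2) powr (1/4) * (T $ 3 $ 3 $ 3 $ 3) powr (1/4) \<and>
          T $ 1 $ 2 $ 2 $ 3 \<ge> (T $ 1 $ 1 $ 1 $ 1) powr (1/4) * (T $ 2 $ 2 $ 2 $ 2) powr (1/2) * (T $ 3 $ 3 $ 3 $ 3) powr (1/4) \<and>
          T $ 1 $ 2 $ 3 $ 3 \<ge> - ((T $ 1 $ 1 $ 1 $ 1) powr (1/4) * (T $ 2 $ 2 $ 2 $ 2) powr (1/4) * (T $ 3 $ 3 $ 3 $ 3) powr (1/2)))"
  shows
    "((\<forall>i j. i \<noteq> j \<longrightarrow>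
         T $ i $ i $ j $ j \<ge> - sqrt (T $ i $ i $ i $ i * T $ j $ j $ j $ j) \<and>
         T $ i $ i $ i $ j \<ge> (T $ i $ i $ i $ i) powr (3/4) * (T $ j $ j $ j $ j) powr (1/4))
       \<longrightarrow> strictly_copositive4 T)
     \<and>
     ((\<forall>i j. i \<noteq> j \<longrightarrow>
         T $ i $ i $ j $ j \<ge> sqrt (T $ i $ i $ i $ i * T $ j $ j $ j $ j) \<and>
         T $ i $ i $ i $ j \<ge> - ((T $ i $ i $ i $ i) powr (3/4) * (T $ j $ j $ j $ j) powr (1/4))) \<and>
      (\<exists>s. s \<noteq> r \<and>
         T $ r $ r $ r $ s \<ge> (T $ r $ r $ r $ r) powr (3/4) * (T $ s $ s $ s $ s) powr (1/4))
       \<longrightarrow> copositive4 T)"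
proof -
  define a where "a i = (T $ i $ i $ i $ i) powr (1/4)" for i
  have a: "0 < a i" and a0: "a i \<noteq> 0" for i
    using diag[of i] by (simp_all add: a_def)
  note roots = fourth_root_powers[OF diag, folded a_def]
  have quarter: "(T $ i $ i $ i $ i) powr (1/4) = a i" for i
    by (simp add: a_def)
  define S where "S = rescale_tensor4 a T"
  have S: "S $ i $ j $ k $ l = T $ i $ j $ k $ l / (a i * a j * a k * a l)" for i j k l
    by (simp add: S_def)
  have symS: "symmetric_tensor4 S"
    unfolding S_def by (rule symmetric_rescale_tensor4[OF sym])
  have unit: "S $ i $ i $ i $ i = 1" for i
    using roots(3)[of i] diag[of i] by (simp add: S power4_eq_xxxx)
  have ge: "c \<le> S $ i $ j $ k $ l \<longleftrightarrow> c * (a i * a j * a k * a l) \<le> T $ i $ j $ k $ l" for c i j k l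
    unfolding S using a by (simp add: pos_le_divide_eq)
  have sqrts: "sqrt (T $ i $ i $ i $ i * T $ j $ j $ j $ j) = a i * a i * a j * a j" for i j
    by (simp add: real_sqrt_mult roots power2_eq_square)
  \<comment> \<open>The three cases differ only in the name of the exceptional index, and the bounds are
    symmetric in the other two.\<close>
  have "- 1 \<le> S $ r $ r $ q $ s \<and> 1 \<le> S $ r $ q $ q $ s \<and> 1 \<le> S $ r $ q $ s $ s"
    if dist: "distinct [r, q, s]" for q s
  proof -
    note swaps = symmetric_tensor4_swaps[OF symS]
    have "(r = 1 \<and> - 1 \<le> S $ 1 $ 1 $ 2 $ 3 \<and> 1 \<le> S $ 1 $ 2 $ 2 $ 3 \<and> 1 \<le> S $ 1 $ 2 $ 3 $ 3)
        \<or> (r = 2 \<and> 1 \<le> S $ 1 $ 1 $ 2 $ 3 \<and> - 1 \<le> S $ 1 $ 2 $ 2 $ 3 \<and> 1 \<le> S $ 1 $ 2 $ 3 $ 3)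
        \<or> (r = 3 \<and> 1 \<le> S $ 1 $ 1 $ 2 $ 3 \<and> 1 \<le> S $ 1 $ 2 $ 2 $ 3 \<and> - 1 \<le> S $ 1 $ 2 $ 3 $ 3)"
      using cases_abc unfolding ge quarter roots(1) by (simp add: power2_eq_square mult_ac)
    then show ?thesis
      using dist exhaust_3[of q] exhaust_3[of s] by (elim disjE conjE) (simp_all add: swaps)
  qed
  then have mixed: "- 1 \<le> S $ r $ r $ q $ s" "1 \<le> S $ r $ q $ q $ s" "1 \<le> S $ r $ q $ s $ s"
    if "distinct [r, q, s]" for q s
    using that by blast+
  have complete: "\<exists>s. distinct [r, q, s]" if "q \<noteq> r" for q
  proof -
    have "card {r, q} < card (UNIV :: 3 set)"
      using that by simp
    then obtain s where "s \<notin> {r, q}"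
      by (metis UNIV_I UNIV_eq_I less_irrefl)
    then show ?thesis
      using that by auto
  qed
  show ?thesis
  proof (intro conjI impI)
    assume H: "\<forall>i j. i \<noteq> j \<longrightarrow>
         T $ i $ i $ j $ j \<ge> - sqrt (T $ i $ i $ i $ i * T $ j $ j $ j $ j) \<and>
         T $ i $ i $ i $ j \<ge> (T $ i $ i $ i $ i) powr (3/4) * (T $ j $ j $ j $ j) powr (1/4)"
    have sq: "- 1 \<le> S $ i $ i $ j $ j" and cub: "1 \<le> S $ i $ i $ i $ j" if "i \<noteq> j" for i j
      using H that unfolding ge sqrts quarter roots(2) by (simp_all add: power3_eq_cube)
    obtain q where "q \<noteq> r"
      by (metis zero_neq_one)
    then obtain s where dist: "distinct [r, q, s]"
      using complete by blast
    show "strictly_copositive4 T"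
      unfolding strictly_copositive4_def
    proof
      fix x :: "real ^ 3"
      assume "x \<in> nonneg_orthant - {0}"
      then have "(\<chi> i. a i * x $ i) \<in> nonneg_orthant - {0}"
        using nonneg_orthant_rescale[of a x] rescale_eq_0_iff[of a x] a a0 by simp
      from unit_diagonal_form_pos[OF symS dist unit mixed[OF dist] sq cub this]
      show "0 < tensor4_form T x"
        unfolding tensor4_form_rescale[of a T x, OF a0] S_def .
    qed
  next
    assume H: "(\<forall>i j. i \<noteq> j \<longrightarrow>
         T $ i $ i $ j $ j \<ge> sqrt (T $ i $ i $ i $ i * T $ j $ j $ j $ j) \<and>
         T $ i $ i $ i $ j \<ge> - ((T $ i $ i $ i $ i) powr (3/4) * (T $ j $ j $ j $ j) powr (1/4))) \<and>
      (\<exists>s. s \<noteq> r \<and>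
         T $ r $ r $ r $ s \<ge> (T $ r $ r $ r $ r) powr (3/4) * (T $ s $ s $ s $ s) powr (1/4))"
    have sq: "1 \<le> S $ i $ i $ j $ j" and cub: "- 1 \<le> S $ i $ i $ i $ j" if "i \<noteq> j" for i j
      using H that unfolding ge sqrts quarter roots(2) by (simp_all add: power3_eq_cube)
    obtain q where "q \<noteq> r" and rq: "1 \<le> S $ r $ r $ r $ q"
      using H unfolding ge quarter roots(2) by (auto simp: power3_eq_cube)
    then obtain s where dist: "distinct [r, q, s]"
      using complete by blast
    show "copositive4 T"
      unfolding copositive4_def
    proof
      fix x :: "real ^ 3"
      assume "x \<in> nonneg_orthant"
      then have "(\<chi> i. a i * x $ i) \<in> nonneg_orthant"
        using nonneg_orthant_rescale[of a x] a by simp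
      from unit_diagonal_form_nonneg[OF symS dist unit mixed[OF dist] sq cub rq this]
      show "0 \<le> tensor4_form T x"
        unfolding tensor4_form_rescale[of a T x, OF a0] S_def .
    qed
  qed
qed

end
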